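(* Let $\mathbb{X}$ be a finite-dimensional polyhedral real Banach space and let $\mathbb{Y}$ be a real Banach space. Let $T\in S_{\mathbb{L}(\mathbb{X},\mathbb{Y})}$. Then there exists $\epsilon_0>0$ such that for any $0<\epsilon<\epsilon_0$, if $A_\epsilon$ is a uniform $\epsilon$-BPB approximation of $T$, then $M_T=M_{A_\epsilon}$.
   Context: A finite-dimensional Banach space is polyhedral if its closed unit ball has only finitely many extreme points. $\mathbb{L}(\mathbb{X},\mathbb{Y})$ is the space of bounded linear operators with the operator norm; $S_Z$ is the unit sphere of a normed space $Z$. For $A\in\mathbb{L}(\mathbb{X},\mathbb{Y})$, $M_A=\{x\in S_{\mathbb{X}}:\|Ax\|=\|A\|\}$. For $T\in S_{\mathbb{L}(\mathbb{X},\mathbb{Y})}$ and $\epsilon>0$, an operator $A\in S_{\mathbb{L}(\mathbb{X},\mathbb{Y})}$ is a uniform $\epsilon$-BPB approximation of $T$ if $\|T-A\|<\epsilon$ and there exists $\delta(\epsilon)>0$ such that for each $x_0\in S_{\mathbb{X}}$ with $\|Tx_0\|>1-\delta(\epsilon)$ there exists $u_0\in M_A$ with $\|u_0-x_0\|<\epsilon$. *)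

theory Defs
  imports "HOL-Analysis.Analysis"
begin

text \<open>
  Normed spaces are types of class \<open>banach\<close>, not \<open>euclidean_space\<close>, whose norm would be
  induced by an inner product. Finite dimension is therefore an explicit condition; it is not
  expressed through \<open>dim\<close>, which is also a number when the space is infinite-dimensional.
\<close>

definition finite_dimensional :: "'a::real_vector itself \<Rightarrow> bool" where
  "finite_dimensional _ \<longleftrightarrow> (\<exists>B :: 'a set. finite B \<and> span B = UNIV)"

definition polyhedral_space :: "'a::real_normed_vector itself \<Rightarrow> bool" where
  "polyhedral_space _ \<longleftrightarrow>
     finite_dimensional TYPE('a) \<and> finite {x :: 'a. x extreme_point_of (cball 0 1)}"

definition norm_attainment_set ::
    "('a::real_normed_vector \<Rightarrow>\<^sub>L 'b::real_normed_vector) \<Rightarrow> 'a set" where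
  "norm_attainment_set A = {x \<in> sphere 0 1. norm (blinfun_apply A x) = norm A}"

definition uniform_BPB_approximation ::
    "real \<Rightarrow> ('a::real_normed_vector \<Rightarrow>\<^sub>L 'b::real_normed_vector) \<Rightarrow> ('a \<Rightarrow>\<^sub>L 'b) \<Rightarrow> bool" where
  "uniform_BPB_approximation \<epsilon> T A \<longleftrightarrow>
     \<epsilon> > 0 \<and> T \<in> sphere 0 1 \<and> A \<in> sphere 0 1 \<and> norm (T - A) < \<epsilon> \<and>
     (\<exists>\<delta>>0. \<forall>x\<^sub>0 \<in> sphere 0 1. norm (blinfun_apply T x\<^sub>0) > 1 - \<delta> \<longrightarrow>
        (\<exists>u\<^sub>0 \<in> norm_attainment_set A. norm (u\<^sub>0 - x\<^sub>0) < \<epsilon>))"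

end

theory Submission
  imports Defs
begin

text \<open>
  The unit ball is the convex hull of its finite set \<open>E\<close> of extreme points, and a contraction
  that attains norm \<open>1\<close> at a point with positive weights on \<open>S \<subseteq> E\<close> attains it on all of
  \<open>convex hull S\<close>. So norm attainment is decided by the finitely many barycenters of subsets of
  \<open>E\<close>. For \<open>\<epsilon>\<close> small, \<open>A\<close> cannot attain its norm at a barycenter where \<open>T\<close> does not; and a
  point within \<open>\<epsilon>\<close> of a barycenter \<open>a\<close> has positive weights only on sets \<open>S\<close> with
  \<open>a \<in> convex hull S\<close>, since the other finitely many hulls are closed and miss \<open>a\<close>.
\<close>

section \<open>Feasible directions in convex sets, and Minkowski's theorem\<close>

text \<open>For convex \<open>B\<close> and \<open>x \<in> B\<close> this is the linear space
  parallel to the smallest face of \<open>B\<close> containing \<open>x\<close>. Its dimension is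
  the measure for the induction in Minkowski's theorem.\<close>

definition feasible_directions :: "'a::real_vector set \<Rightarrow> 'a \<Rightarrow> 'a set" where
  "feasible_directions B x = {d. \<exists>r>0. x + r *\<^sub>R d \<in> B \<and> x - r *\<^sub>R d \<in> B}"

lemma convex_add_smaller_step:
  fixes x d :: "'a::real_vector"
  assumes "convex B" "x \<in> B" "x + r *\<^sub>R d \<in> B" "0 \<le> s" "s \<le> r"
  shows "x + s *\<^sub>R d \<in> B"
proof (cases "r = 0")
  case True
  then show ?thesis using assms by simp
next
  case False
  then have "r > 0" using assms by simp
  have "(1 - s / r) *\<^sub>R x + (s / r) *\<^sub>R (x + r *\<^sub>R d) \<in> B"
    using assms \<open>r > 0\<close> by (intro convexD) (auto simp: divide_simps)
  also have "(1 - s / r) *\<^sub>R x + (s / r) *\<^sub>R (x + r *\<^sub>R d) = x + s *\<^sub>R d"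
    using \<open>r > 0\<close> by (simp add: algebra_simps)
  finally show ?thesis .
qed

lemma subspace_feasible_directions:
  fixes B :: "'a::real_vector set"
  assumes B: "convex B" and x: "x \<in> B"
  shows "subspace (feasible_directions B x)"
proof (rule subspaceI)
  show "0 \<in> feasible_directions B x"
    using x by (auto simp: feasible_directions_def intro!: exI[of _ 1])
next
  fix d e assume "d \<in> feasible_directions B x" "e \<in> feasible_directions B x"
  then obtain p q where p: "p > 0" "x + p *\<^sub>R d \<in> B" "x - p *\<^sub>R d \<in> B"
    and q: "q > 0" "x + q *\<^sub>R e \<in> B" "x - q *\<^sub>R e \<in> B"
    by (auto simp: feasible_directions_def)
  \<comment> \<open>A common step size lets the midpoint of \<open>x + r d\<close> and
    \<open>x + r e\<close> serve as a step of size \<open>r/2\<close> along \<open>d + e\<close>;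
    the same is then done with \<open>- d\<close> and \<open>- e\<close>.\<close>
  define r where "r = min p q"
  have r: "r > 0" "r \<le> p" "r \<le> q" using p q by (auto simp: r_def)
  have plus: "x + r *\<^sub>R d \<in> B" "x + r *\<^sub>R e \<in> B"
    using convex_add_smaller_step[OF B x p(2), of r] convex_add_smaller_step[OF B x q(2), of r] r
    by auto
  have minus: "x + r *\<^sub>R (- d) \<in> B" "x + r *\<^sub>R (- e) \<in> B"
    using convex_add_smaller_step[OF B x, of p "- d" r]
      convex_add_smaller_step[OF B x, of q "- e" r] p q r
    by auto
  have half: "(1/2) *\<^sub>R (x + r *\<^sub>R c) + (1/2) *\<^sub>R (x + r *\<^sub>R c') = x + (r/2) *\<^sub>R (c + c')"
    for c c' :: 'a
  proof -
    have "(1/2) *\<^sub>R x + (1/2) *\<^sub>R x = x"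
      by (simp flip: scaleR_add_left)
    then show ?thesis by (simp add: algebra_simps)
  qed
  have "x + (r/2) *\<^sub>R (d + e) \<in> B"
    using convexD[OF B plus, of "1/2" "1/2"] half[of d e] by simp
  moreover have "x + (r/2) *\<^sub>R (- d + - e) \<in> B"
    using convexD[OF B minus, of "1/2" "1/2"] half[of "- d" "- e"] by simp
  then have "x - (r/2) *\<^sub>R (d + e) \<in> B"
    by (simp add: algebra_simps)
  ultimately show "d + e \<in> feasible_directions B x"
    using r unfolding feasible_directions_def
    by (intro CollectI exI[of _ "r/2"]) simp
next
  fix c :: real and d assume "d \<in> feasible_directions B x"
  then obtain r where r: "r > 0" "x + r *\<^sub>R d \<in> B" "x - r *\<^sub>R d \<in> B"
    by (auto simp: feasible_directions_def)
  show "c *\<^sub>R d \<in> feasible_directions B x"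
  proof (cases c "0::real" rule: linorder_cases)
    case equal
    then show ?thesis
      using x by (auto simp: feasible_directions_def intro!: exI[of _ 1])
  next
    case greater
    then show ?thesis
      using r by (auto simp: feasible_directions_def intro!: exI[of _ "r / c"])
  next
    \<comment> \<open>A negative \<open>c\<close> swaps the two end points of the segment, so the
      positive step is \<open>- r / c\<close>.\<close>
    case less
    then show ?thesis
      using r by (auto simp: feasible_directions_def divide_pos_neg intro!: exI[of _ "- r / c"])
  qed
qed

text \<open>The parameters of the points of the ray inside \<open>B\<close> form a nonempty, closed
  and bounded set of reals, which contains its supremum.\<close>

lemma last_point_on_ray:
  fixes B :: "'a::real_normed_vector set"
  assumes "closed B" "bounded B" "x \<in> B" "d \<noteq> 0"
  obtains t where "t \<ge> 0" "x + t *\<^sub>R d \<in> B" "\<And>s. s > t \<Longrightarrow> x + s *\<^sub>R d \<notin> B"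
proof -
  define I where "I = {t. t \<ge> 0 \<and> x + t *\<^sub>R d \<in> B}"
  obtain K where K: "\<And>y. y \<in> B \<Longrightarrow> norm y \<le> K"
    using \<open>bounded B\<close> by (auto simp: bounded_iff)
  have bdd: "t \<le> (K + norm x) / norm d" if "t \<in> I" for t
  proof -
    have "t * norm d = norm ((x + t *\<^sub>R d) - x)"
      using that by (simp add: I_def)
    also have "\<dots> \<le> K + norm x"
      using norm_triangle_ineq4[of "x + t *\<^sub>R d" x] K[of "x + t *\<^sub>R d"] that
      by (simp add: I_def)
    finally show ?thesis using \<open>d \<noteq> 0\<close> by (simp add: field_simps)
  qed
  have "0 \<in> I" using \<open>x \<in> B\<close> by (simp add: I_def)
  have bdda: "bdd_above I" using bdd by (rule bdd_aboveI)
  have "closed I"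
  proof -
    have "I = {0..} \<inter> (\<lambda>t. x + t *\<^sub>R d) -` B" by (auto simp: I_def)
    also have "closed \<dots>"
      by (intro closed_Int closed_atLeast continuous_closed_vimage \<open>closed B\<close> continuous_intros)
    finally show ?thesis .
  qed
  then have "Sup I \<in> I"
    using closed_contains_Sup[of I] \<open>0 \<in> I\<close> bdda by blast
  moreover have "x + s *\<^sub>R d \<notin> B" if "s > Sup I" for s
  proof
    assume "x + s *\<^sub>R d \<in> B"
    then have "s \<in> I" using that \<open>Sup I \<in> I\<close> by (simp add: I_def)
    then show False using cSup_upper[OF _ bdda] that by force
  qed
  ultimately show thesis using that[of "Sup I"] unfolding I_def by blast
qed

text \<open>Contracting towards \<open>x - r d\<close> carries a segment around the last point to a
  parallel segment around \<open>x\<close>, so no direction is gained. The direction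
  \<open>d\<close> is lost, because the ray cannot be prolonged inside \<open>B\<close>.\<close>

lemma feasible_directions_last_point_psubset:
  fixes B :: "'a::real_vector set"
  assumes B: "convex B" and d: "d \<in> feasible_directions B x"
    and t: "t \<ge> 0" "x + t *\<^sub>R d \<in> B" "\<And>s. s > t \<Longrightarrow> x + s *\<^sub>R d \<notin> B"
  shows "feasible_directions B (x + t *\<^sub>R d) \<subset> feasible_directions B x"
proof
  obtain r where r: "r > 0" "x - r *\<^sub>R d \<in> B"
    using d by (auto simp: feasible_directions_def)
  \<comment> \<open>With this ratio, \<open>x\<close> is the combination of \<open>x + t d\<close>
    and \<open>x - r d\<close> with weights \<open>c\<close> and \<open>1 - c\<close>: the
    \<open>d\<close> terms cancel.\<close>
  define c where "c = r / (r + t)"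
  have c: "0 < c" "c \<le> 1" "(1 - c) * r = c * t"
    using r t by (auto simp: c_def divide_simps algebra_simps)
  show "feasible_directions B (x + t *\<^sub>R d) \<subseteq> feasible_directions B x"
  proof
    fix e assume "e \<in> feasible_directions B (x + t *\<^sub>R d)"
    then obtain q where q: "q > 0" "x + t *\<^sub>R d + q *\<^sub>R e \<in> B" "x + t *\<^sub>R d - q *\<^sub>R e \<in> B"
      by (auto simp: feasible_directions_def)
    have eq: "c *\<^sub>R (x + t *\<^sub>R d + z) + (1 - c) *\<^sub>R (x - r *\<^sub>R d) = x + c *\<^sub>R z" for z
    proof -
      have "c *\<^sub>R (x + t *\<^sub>R d + z) + (1 - c) *\<^sub>R (x - r *\<^sub>R d)
          = (c + (1 - c)) *\<^sub>R x + (c * t - (1 - c) * r) *\<^sub>R d + c *\<^sub>R z"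
        by (simp add: algebra_simps)
      then show ?thesis using c by simp
    qed
    have "x + c *\<^sub>R (q *\<^sub>R e) \<in> B"
      using convexD[OF B q(2) r(2), of c "1 - c"] c by (simp add: eq)
    moreover have "x + c *\<^sub>R (- (q *\<^sub>R e)) \<in> B"
      using convexD[OF B q(3) r(2), of c "1 - c"] c eq[of "- (q *\<^sub>R e)"] by simp
    ultimately show "e \<in> feasible_directions B x"
      using c q by (auto simp: feasible_directions_def intro!: exI[of _ "c * q"])
  qed
  have "d \<notin> feasible_directions B (x + t *\<^sub>R d)"
  proof
    assume "d \<in> feasible_directions B (x + t *\<^sub>R d)"
    then obtain q where "q > 0" "x + (t + q) *\<^sub>R d \<in> B"
      by (auto simp: feasible_directions_def algebra_simps)
    then show False using t(3)[of "t + q"] by simp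
  qed
  with d show "feasible_directions B (x + t *\<^sub>R d) \<noteq> feasible_directions B x"
    by blast
qed

text \<open>A finite spanning set contains a finite basis, which instantiates the locale of
  finite-dimensional vector spaces; strict monotonicity of \<open>dim\<close> is then inherited from
  there. It makes the induction on \<open>dim\<close> decrease.\<close>

lemma finite_dimensional_dim_psubset:
  fixes U V :: "'a::real_vector set"
  assumes "finite_dimensional TYPE('a)" "subspace U" "subspace V" "U \<subset> V"
  shows "dim U < dim V"
proof -
  obtain C :: "'a set" where C: "finite C" "span C = UNIV"
    using assms(1) by (auto simp: finite_dimensional_def)
  obtain D where D: "D \<subseteq> C" "independent D" "C \<subseteq> span D"
    using maximal_independent_subset by blast
  have "span D = UNIV"
    using C D span_mono[of C "span D"] by (auto simp: span_span)
  interpret fd: finite_dimensional_vector_space "scaleR :: real \<Rightarrow> 'a \<Rightarrow> 'a" D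
    using D C \<open>span D = UNIV\<close>
    by unfold_locales
      (auto simp: finite_subset algebra_simps dependent_raw_def span_raw_def)
  show ?thesis
    using fd.dim_psubset[of U V, folded span_raw_def dim_raw_def] assms
    by (simp add: span_eq_iff[THEN iffD2])
qed

text \<open>
  Minkowski's theorem; the library version requires \<open>euclidean_space\<close>. A point that is not
  extreme lies between the two ends of a chord, where the space of feasible directions is smaller.
\<close>

lemma finite_dimensional_closed_bounded_convex_subset_hull_extreme_points:
  fixes B :: "'a::real_normed_vector set"
  assumes fd: "finite_dimensional TYPE('a)"
    and B: "closed B" "bounded B" "convex B" and "x \<in> B"
  shows "x \<in> convex hull {e. e extreme_point_of B}"
  using \<open>x \<in> B\<close>
proof (induction "dim (feasible_directions B x)" arbitrary: x rule: less_induct)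
  case (less x)
  show ?case
  proof (cases "x extreme_point_of B")
    case True
    then show ?thesis by (intro hull_inc) simp
  next
    case False
    then obtain a b where ab: "a \<in> B" "b \<in> B" "x \<in> open_segment a b"
      using less.prems by (auto simp: extreme_point_of_def)
    then obtain u where u: "0 < u" "u < 1" "x = (1 - u) *\<^sub>R a + u *\<^sub>R b" and "a \<noteq> b"
      by (auto simp: in_segment)
    define d where "d = b - a"
    have "d \<noteq> 0" using \<open>a \<noteq> b\<close> by (simp add: d_def)
    have "a = x + u *\<^sub>R (- d)" "b = x + (1 - u) *\<^sub>R d"
      using u by (simp_all add: d_def algebra_simps)
    then have steps: "x + u *\<^sub>R (- d) \<in> B" "x + (1 - u) *\<^sub>R d \<in> B"
      using ab by simp_all
    \<comment> \<open>The point \<open>x\<close> need not be the middle of the segment; the shorter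
      side gives a step that is allowed both ways.\<close>
    define r where "r = min u (1 - u)"
    have "r > 0" using u by (simp add: r_def)
    moreover have "x + r *\<^sub>R (- d) \<in> B" "x + r *\<^sub>R d \<in> B"
      using steps u less.prems B
      by (auto intro: convex_add_smaller_step simp: r_def simp del: scaleR_minus_right)
    ultimately have d: "d \<in> feasible_directions B x" "- d \<in> feasible_directions B x"
      by (auto simp: feasible_directions_def)
    have ray: "\<exists>t\<ge>0. x + t *\<^sub>R e \<in> convex hull {e. e extreme_point_of B}"
      if e: "e \<in> feasible_directions B x" "e \<noteq> 0" for e
    proof -
      obtain t where t: "t \<ge> 0" "x + t *\<^sub>R e \<in> B" "\<And>s. s > t \<Longrightarrow> x + s *\<^sub>R e \<notin> B"
        using last_point_on_ray[of B x e] B less.prems e by blast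
      have "dim (feasible_directions B (x + t *\<^sub>R e)) < dim (feasible_directions B x)"
        using feasible_directions_last_point_psubset[OF B(3) e(1) t] less.prems t B
        by (intro finite_dimensional_dim_psubset fd subspace_feasible_directions) auto
      then show ?thesis using less.hyps t by blast
    qed
    obtain s where s: "s \<ge> 0" "x + s *\<^sub>R d \<in> convex hull {e. e extreme_point_of B}"
      using ray[OF d(1)] \<open>d \<noteq> 0\<close> by blast
    obtain t where t: "t \<ge> 0" "x + t *\<^sub>R (- d) \<in> convex hull {e. e extreme_point_of B}"
      using ray[OF d(2)] \<open>d \<noteq> 0\<close> by auto
    show ?thesis
    proof (cases "s + t = 0")
      case True
      then have "s = 0" using s t by simp
      then show ?thesis using s by simp
    next
      case False
      then have pos: "s + t > 0" using s t by simp
      have one: "t / (s + t) + s / (s + t) = 1"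
        using pos by (simp add: add.commute flip: add_divide_distrib)
      \<comment> \<open>The weights are crossed, each end weighted by the distance parameter of the
        other, so that the \<open>d\<close> terms cancel and only \<open>x\<close> remains.\<close>
      have "(t / (s + t)) *\<^sub>R (x + s *\<^sub>R d) + (s / (s + t)) *\<^sub>R (x + t *\<^sub>R (- d))
          \<in> convex hull {e. e extreme_point_of B}"
        using s t pos one by (intro convexD convex_convex_hull) auto
      also have "(t / (s + t)) *\<^sub>R (x + s *\<^sub>R d) + (s / (s + t)) *\<^sub>R (x + t *\<^sub>R (- d))
          = (t / (s + t) + s / (s + t)) *\<^sub>R x"
        by (simp add: algebra_simps)
      finally show ?thesis by (simp add: one)
    qed
  qed
qed

section \<open>Positive convex combinations and norm attainment\<close>

text \<open>For finite \<open>S\<close> these \<open>u\<close> are the points of the relative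
  interior of \<open>convex hull S\<close>.\<close>

definition has_positive_weights :: "'a::real_vector set \<Rightarrow> 'a \<Rightarrow> bool" where
  "has_positive_weights S u \<longleftrightarrow>
     (\<exists>w. (\<forall>v\<in>S. 0 < w v) \<and> sum w S = 1 \<and> (\<Sum>v\<in>S. w v *\<^sub>R v) = u)"

lemma has_positive_weights_imp_in_hull:
  assumes "finite S" "has_positive_weights S u"
  shows "u \<in> convex hull S"
  using assms unfolding has_positive_weights_def convex_hull_finite[OF assms(1)]
  by (blast intro: less_imp_le)

text \<open>Dropping the points of weight zero changes neither the total weight nor the
  combination.\<close>

lemma convex_hull_finite_positive_weights:
  fixes E :: "'a::real_vector set"
  assumes "finite E" "u \<in> convex hull E"
  obtains S where "S \<subseteq> E" "S \<noteq> {}" "has_positive_weights S u"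
proof -
  obtain w where w: "\<forall>v\<in>E. 0 \<le> w v" "sum w E = 1" "(\<Sum>v\<in>E. w v *\<^sub>R v) = u"
    using assms by (auto simp: convex_hull_finite)
  define S where "S = {v \<in> E. w v > 0}"
  have "S \<subseteq> E" by (auto simp: S_def)
  have z: "\<forall>v\<in>E - S. w v = 0" using w by (force simp: S_def)
  have "sum w S = 1"
    using sum.mono_neutral_right[OF assms(1) \<open>S \<subseteq> E\<close> z] w(2) by simp
  moreover have "(\<Sum>v\<in>S. w v *\<^sub>R v) = u"
    using sum.mono_neutral_right[OF assms(1) \<open>S \<subseteq> E\<close>, of "\<lambda>v. w v *\<^sub>R v"] z w(3) by simp
  ultimately have "has_positive_weights S u"
    unfolding has_positive_weights_def by (intro exI[of _ w]) (auto simp: S_def)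
  moreover have "S \<noteq> {}" using \<open>sum w S = 1\<close> by auto
  ultimately show thesis using that[of S] by (auto simp: S_def)
qed

definition barycenter :: "'a::real_vector set \<Rightarrow> 'a" where
  "barycenter S = (\<Sum>v\<in>S. (1 / real (card S)) *\<^sub>R v)"

lemma has_positive_weights_barycenter:
  assumes "finite S" "S \<noteq> {}"
  shows "has_positive_weights S (barycenter S)"
  unfolding has_positive_weights_def barycenter_def
  using assms by (intro exI[of _ "\<lambda>_. 1 / real (card S)"]) (auto simp: card_gt_0_iff)

text \<open>As all weights of \<open>u\<close> are positive, a small multiple \<open>s x\<close> can
  be split off from \<open>u\<close>, leaving a combination of \<open>S\<close> with nonnegative
  weights of total \<open>1 - s\<close>. Then
  \<open>1 = norm (A u) \<le> s * norm (A x) + (1 - s)\<close>, which forces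
  \<open>norm (A x) \<ge> 1\<close>.\<close>

lemma norm_blinfun_eq_1_on_hull:
  fixes A :: "'a::real_normed_vector \<Rightarrow>\<^sub>L 'b::real_normed_vector"
  assumes S: "finite S" "S \<subseteq> cball 0 1" and A: "norm A = 1"
    and u: "has_positive_weights S u" "norm (A u) = 1" and x: "x \<in> convex hull S"
  shows "norm (A x) = 1"
proof -
  have le: "norm (A y) \<le> norm y" for y
    using norm_blinfun[of A y] A by simp
  have le1: "norm (A v) \<le> 1" if "v \<in> S" for v
    using le[of v] S that by force
  have "convex hull S \<subseteq> cball 0 1"
    using S by (intro hull_minimal) auto
  then have "norm (A x) \<le> 1" using le[of x] x by force
  obtain w where w: "\<forall>v\<in>S. 0 < w v" "sum w S = 1" "(\<Sum>v\<in>S. w v *\<^sub>R v) = u"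
    using u by (auto simp: has_positive_weights_def)
  obtain m where m: "\<forall>v\<in>S. 0 \<le> m v" "sum m S = 1" "(\<Sum>v\<in>S. m v *\<^sub>R v) = x"
    using x S by (auto simp: convex_hull_finite)
  have "S \<noteq> {}" using w by auto
  \<comment> \<open>The smallest weight of \<open>u\<close> works: the weights \<open>m v\<close> of
    \<open>x\<close> are at most 1, so \<open>s * m v \<le> w v\<close>.\<close>
  define s where "s = Min (w ` S)"
  have s: "s > 0" "\<And>v. v \<in> S \<Longrightarrow> s \<le> w v"
    using S \<open>S \<noteq> {}\<close> w by (auto simp: s_def)
  have m_le: "m v \<le> 1" if "v \<in> S" for v
    using member_le_sum[of v S m] m S that by auto
  then have rest: "0 \<le> w v - s * m v" if "v \<in> S" for v
    using s(1) s(2)[OF that] mult_left_le[of "m v" s] m_le[OF that] by (smt (verit))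
  have "u = s *\<^sub>R x + (\<Sum>v\<in>S. (w v - s * m v) *\<^sub>R v)"
    by (simp add: scaleR_diff_left sum_subtractf w flip: m(3) scaleR_scaleR scaleR_sum_right)
  then have "A u = s *\<^sub>R A x + (\<Sum>v\<in>S. (w v - s * m v) *\<^sub>R A v)"
    by (simp add: blinfun.add_right blinfun.sum_right blinfun.scaleR_right)
  then have "1 \<le> norm (s *\<^sub>R A x) + norm (\<Sum>v\<in>S. (w v - s * m v) *\<^sub>R A v)"
    using norm_triangle_ineq u by metis
  also have "norm (\<Sum>v\<in>S. (w v - s * m v) *\<^sub>R A v) \<le> (\<Sum>v\<in>S. w v - s * m v)"
    using rest le1 by (intro sum_norm_le) (auto intro: mult_left_le)
  also have "\<dots> = 1 - s"
    using w m by (simp add: sum_subtractf flip: sum_distrib_left)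
  finally have "s \<le> s * norm (A x)" using s by simp
  with \<open>s > 0\<close> \<open>norm (A x) \<le> 1\<close> show ?thesis by simp
qed

section \<open>The threshold for \<open>\<epsilon>\<close> and the two inclusions\<close>

lemma finite_positive_lower_bound:
  fixes f :: "'i \<Rightarrow> real"
  assumes "finite I"
  obtains c where "c > 0" "\<And>i. i \<in> I \<Longrightarrow> f i > 0 \<Longrightarrow> c \<le> f i"
proof
  \<comment> \<open>The element 1 keeps the set nonempty when no \<open>f i\<close> is
    positive.\<close>
  let ?J = "insert 1 (f ` {i \<in> I. f i > 0})"
  show "Min ?J > 0" using assms by auto
  show "Min ?J \<le> f i" if "i \<in> I" "f i > 0" for i
    using assms that by (intro Min_le) auto
qed

theorem theorem3p11:
  fixes T :: "'a::banach \<Rightarrow>\<^sub>L 'b::banach"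
  assumes "polyhedral_space TYPE('a)"
    and "T \<in> sphere 0 1"
  shows "\<exists>\<epsilon>\<^sub>0>0. \<forall>\<epsilon>. 0 < \<epsilon> \<and> \<epsilon> < \<epsilon>\<^sub>0 \<longrightarrow>
           (\<forall>A. uniform_BPB_approximation \<epsilon> T A \<longrightarrow>
              norm_attainment_set T = norm_attainment_set A)"
proof -
  define E where "E = {x :: 'a. x extreme_point_of (cball 0 1)}"
  have E: "finite E" "E \<subseteq> cball 0 1"
    using assms(1) by (auto simp: E_def polyhedral_space_def extreme_point_of_def)
  have support: "\<exists>S. S \<subseteq> E \<and> S \<noteq> {} \<and> has_positive_weights S x" if "norm x = 1" for x
  proof -
    have "x \<in> convex hull E"
      using that assms(1) unfolding E_def polyhedral_space_def
      by (intro finite_dimensional_closed_bounded_convex_subset_hull_extreme_points) auto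
    then show ?thesis using convex_hull_finite_positive_weights[OF E(1)] by metis
  qed
  have "norm T = 1" using assms(2) by simp
  \<comment> \<open>No barycenter has an image under \<open>T\<close> of norm strictly between
    \<open>1 - c\<close> and 1. The empty set in \<open>Pow E\<close> has barycenter 0 and only
    forces \<open>c \<le> 1\<close>.\<close>
  obtain c where c: "c > 0" "\<And>S. S \<in> Pow E \<Longrightarrow> 1 - norm (T (barycenter S)) > 0 \<Longrightarrow>
      c \<le> 1 - norm (T (barycenter S))"
    using finite_positive_lower_bound[of "Pow E" "\<lambda>S. 1 - norm (T (barycenter S))"] E(1)
    by auto
  \<comment> \<open>A barycenter closer than \<open>\<eta>\<close> to the hull of a subset of
    \<open>E\<close> has \<open>infdist\<close> 0 from it. As \<open>infdist\<close> from the empty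
    set is 0 by convention, the empty hull imposes no bound.\<close>
  obtain \<eta> where \<eta>: "\<eta> > 0" "\<And>p. p \<in> Pow E \<times> Pow E \<Longrightarrow>
      infdist (barycenter (fst p)) (convex hull (snd p)) > 0 \<Longrightarrow>
      \<eta> \<le> infdist (barycenter (fst p)) (convex hull (snd p))"
    using finite_positive_lower_bound[of "Pow E \<times> Pow E"
        "\<lambda>p. infdist (barycenter (fst p)) (convex hull (snd p))"] E(1)
    by auto
  have "norm_attainment_set T = norm_attainment_set A"
    if \<epsilon>: "0 < \<epsilon>" "\<epsilon> < min c \<eta>" and approx: "uniform_BPB_approximation \<epsilon> T A" for \<epsilon> A
  proof -
    have A: "norm A = 1" "norm (T - A) < \<epsilon>"
      using approx by (auto simp: uniform_BPB_approximation_def)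
    obtain \<delta> where \<delta>: "\<delta> > 0" "\<forall>x \<in> sphere 0 1. norm (T x) > 1 - \<delta> \<longrightarrow>
        (\<exists>u \<in> norm_attainment_set A. norm (u - x) < \<epsilon>)"
      using approx unfolding uniform_BPB_approximation_def by blast
    show ?thesis
    proof
      show "norm_attainment_set A \<subseteq> norm_attainment_set T"
      proof
        fix u assume "u \<in> norm_attainment_set A"
        then have u: "norm u = 1" "norm (A u) = 1" using A by (auto simp: norm_attainment_set_def)
        obtain S where S: "S \<subseteq> E" "S \<noteq> {}" "has_positive_weights S u"
          using support u by blast
        have S': "finite S" "S \<subseteq> cball 0 1" using S E by (auto intro: finite_subset)
        let ?a = "barycenter S"
        have a: "has_positive_weights S ?a"
          using S S' by (intro has_positive_weights_barycenter)
        have hull: "?a \<in> convex hull S" "u \<in> convex hull S"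
          using a S S' by (auto intro: has_positive_weights_imp_in_hull)
        have "norm (A ?a) = 1"
          by (rule norm_blinfun_eq_1_on_hull[OF S' A(1) S(3) u(2) hull(1)])
        have "convex hull S \<subseteq> cball 0 1"
          using S' by (intro hull_minimal) auto
        then have "norm ?a \<le> 1" using hull by auto
        have "norm (T ?a - A ?a) \<le> norm (T - A)"
          using norm_blinfun[of "T - A" ?a] \<open>norm ?a \<le> 1\<close>
            mult_left_le[of "norm ?a" "norm (T - A)"]
          by (simp add: blinfun.diff_left)
        \<comment> \<open>By the reverse triangle inequality \<open>T\<close> loses less than
          \<open>\<epsilon> < c\<close> against \<open>norm (A ?a) = 1\<close>; the gap below 1 then
          leaves only the value 1.\<close>
        then have "norm (T ?a) > 1 - c"
          using norm_triangle_ineq2[of "A ?a" "T ?a"] \<open>norm (A ?a) = 1\<close> A \<epsilon>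
          by (simp add: norm_minus_commute)
        then have "norm (T ?a) \<ge> 1" using c(2)[of S] S by auto
        moreover have "norm (T ?a) \<le> 1"
          using norm_blinfun[of T ?a] \<open>norm ?a \<le> 1\<close> \<open>norm T = 1\<close> by simp
        ultimately have "norm (T ?a) = 1" by simp
        then have "norm (T u) = 1"
          using norm_blinfun_eq_1_on_hull[OF S' \<open>norm T = 1\<close> a _ hull(2)] by simp
        then show "u \<in> norm_attainment_set T"
          using u \<open>norm T = 1\<close> by (simp add: norm_attainment_set_def)
      qed
      show "norm_attainment_set T \<subseteq> norm_attainment_set A"
      proof
        fix x assume "x \<in> norm_attainment_set T"
        then have x: "norm x = 1" "norm (T x) = 1"
          using \<open>norm T = 1\<close> by (auto simp: norm_attainment_set_def)
        obtain S where S: "S \<subseteq> E" "S \<noteq> {}" "has_positive_weights S x"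
          using support x by blast
        have S': "finite S" "S \<subseteq> cball 0 1" using S E by (auto intro: finite_subset)
        let ?a = "barycenter S"
        have a: "has_positive_weights S ?a"
          using S S' by (intro has_positive_weights_barycenter)
        have hull: "?a \<in> convex hull S" "x \<in> convex hull S"
          using a S S' by (auto intro: has_positive_weights_imp_in_hull)
        have Ta: "norm (T ?a) = 1"
          by (rule norm_blinfun_eq_1_on_hull[OF S' \<open>norm T = 1\<close> S(3) x(2) hull(1)])
        have "convex hull S \<subseteq> cball 0 1"
          using S' by (intro hull_minimal) auto
        then have "norm ?a = 1"
          using hull norm_blinfun[of T ?a] Ta \<open>norm T = 1\<close> by force
        \<comment> \<open>Since \<open>norm (T ?a) = 1\<close>, the barycenter exceeds the bound
          \<open>1 - \<delta>\<close> for any positive \<open>\<delta>\<close>, so a threshold for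
          \<open>\<epsilon>\<close> that does not depend on \<open>\<delta>\<close>
          suffices.\<close>
        then obtain u where "u \<in> norm_attainment_set A" "norm (u - ?a) < \<epsilon>"
          using \<delta>(1) \<delta>(2)[rule_format, of ?a] Ta by auto
        then have u: "norm u = 1" "norm (A u) = 1" "dist ?a u < \<epsilon>"
          using A by (auto simp: norm_attainment_set_def dist_norm norm_minus_commute)
        obtain R where R: "R \<subseteq> E" "R \<noteq> {}" "has_positive_weights R u"
          using support u by blast
        have R': "finite R" "R \<subseteq> cball 0 1" using R E by (auto intro: finite_subset)
        \<comment> \<open>\<open>u\<close> lies in the hull of \<open>R\<close> and within
          \<open>\<epsilon> < \<eta>\<close> of the barycenter, so the choice of
          \<open>\<eta>\<close> forces distance 0.\<close>
        have "infdist ?a (convex hull R) \<le> dist ?a u"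
          using R R' by (intro infdist_le has_positive_weights_imp_in_hull)
        then have "infdist ?a (convex hull R) < \<eta>" using u \<epsilon> by simp
        then have "infdist ?a (convex hull R) = 0"
          using \<eta>(2)[of "(S, R)"] S R infdist_nonneg[of ?a "convex hull R"] by force
        moreover have "closed (convex hull R)"
          using R' by (intro compact_imp_closed finite_imp_compact_convex_hull)
        ultimately have "?a \<in> convex hull R"
          using R by (simp add: in_closed_iff_infdist_zero)
        \<comment> \<open>Attainment passes from \<open>u\<close> to \<open>?a\<close> inside the
          hull of \<open>R\<close>, and next from \<open>?a\<close> to \<open>x\<close> inside the
          hull of \<open>S\<close>.\<close>
        then have "norm (A ?a) = 1"
          by (rule norm_blinfun_eq_1_on_hull[OF R' A(1) R(3) u(2)])
        then have "norm (A x) = 1"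
          using norm_blinfun_eq_1_on_hull[OF S' A(1) a _ hull(2)] by simp
        then show "x \<in> norm_attainment_set A"
          using x A by (simp add: norm_attainment_set_def)
      qed
    qed
  qed
  then show ?thesis using c(1) \<eta>(1) by (intro exI[of _ "min c \<eta>"]) auto
qed

end
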